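(* Let $\Sigma=(\mathcal A,\mathcal A_1,\mathcal G,E,X,U,h)$ be a dt-SNPS-td with input set $U=\{u\in\mathbb R^m\mid b_j^\top u\le 1,\ j=1,\dots,J\}$, $b_j\in\mathbb R^m$, and let $X_a,X_b\subset X$ be its initial and unsafe sets. Let $\gamma_a,\gamma_b\in\mathbb R^+$ with $\gamma_b>\gamma_a$. Suppose there exist matrices $P\succ0$, $P_1\succeq0$, a symmetric matrix $\mathcal S$ (all in $\mathbb R^{n\times n}$), polynomial matrices $\mathcal F=F(x,x_h)\in\mathbb R^{m\times n}$, $\mathcal F_1=F_1(x,x_h)\in\mathbb R^{m\times n}$, and a constant $\alpha\in\mathbb R^+$ such that $$x^\top Px+h\,\bar x^\top P_1\bar x\le\gamma_a\quad\forall(x,\bar x)\in X_a^2,$$ $$x^\top Px\ge\gamma_b\quad\forall x\in X_b,$$ $$\begin{bmatrix}P-P_1&\mathbf 0&(\mathcal A+\mathcal G\mathcal F)^\top\\ \star&P_1&(\mathcal A_1+\mathcal G\mathcal F_1)^\top\\ \star&\star&\mathcal S\end{bmatrix}\succeq0\quad\forall(x,x_h)\in X^2,$$ $$P\preceq\tfrac1\alpha\mathbf I_n,\qquad \mathcal S\preceq\alpha\mathbf I_n,$$ $$1-b_j^\top(\mathcal Fx+\mathcal F_1x_h)\ge0\quad\forall(x,x_h)\in X^2,\ j=1,\dots,J.$$ Then, with $\mathcal B(\mathbf x)=x^\top Px+\sum_{i=1}^hx_i^\top P_1x_i$, the state feedback $u=\mathcal Fx+\mathcal F_1x_h$, and $\eta=\mathrm{Tr}(E^\top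 PE)$, the following hold: (i) $\mathcal B(\mathbf x)\le\gamma_a$ for all $\mathbf x\in X_a^{h+1}$; (ii) $\mathcal B(\mathbf x)\ge\gamma_b$ for all $\mathbf x\in X_b\times(X\setminus X_b)^h$; (iii) for all $\mathbf x\in X^{h+1}$, $\ \mathbb E[\mathcal B(\mathbf x_{k+1})\mid\mathbf x_k=\mathbf x,u_k=u]-\mathcal B(\mathbf x)\le\eta$; (iv) $u=\mathcal Fx+\mathcal F_1x_h\in U$ for all $(x,x_h)\in X^2$.
   Context: $\mathbb R^+$ denotes the positive reals. $P\succ0$ ($\succeq0$) means symmetric positive definite (semidefinite); $\star$ denotes the transposed entry in the symmetric position; $\mathbf I_n$ is the identity, $\mathbf 0$ a zero block. A discrete-time stochastic nonlinear polynomial system with time-invariant delay (dt-SNPS-td) $\Sigma=(\mathcal A,\mathcal A_1,\mathcal G,E,X,U,h)$ is $$x_{k+1}=A(x_k,x_{k-h})x_k+A_1(x_k,x_{k-h})x_{k-h}+G(x_k,x_{k-h})u_k+Ew_k,\quad k\in\mathbb N,$$ where $h\in\mathbb N^+$ is the delay; $x_k,x_{k-h}\in X$ with $X\subseteq\mathbb R^n$ Borel; $u_k\in U$; $(w_k)$ are i.i.d. with standard normal distribution $\mathcal N(\mathbf 0,\mathbf I_n)$; $A(\cdot,\cdot),A_1(\cdot,\cdot)\in\mathbb R^{n\times n}$ and $G(\cdot,\cdot)\in\mathbb R^{n\times m}$ are polynomial matrices and $E\in\mathbb R^{n\times n}$ is constant. Abbreviations: $\mathcal A=A(x,x_h)$,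 $\mathcal A_1=A_1(x,x_h)$, $\mathcal G=G(x,x_h)$. The state history at time $k$ is $\mathbf x_k=(x_k,x_{k-1},\dots,x_{k-h})\in X^{h+1}$, with successor $\mathbf x_{k+1}=(x_{k+1},x_k,\dots,x_{k-h+1})$; a generic history is written $\mathbf x=(x,x_1,\dots,x_h)$, with $x$ the current and $x_h$ the $h$-step delayed state. The conditional expectation is over $w_k\sim\mathcal N(\mathbf 0,\mathbf I_n)$, with $x_{k+1}$ given by the dynamics and $\mathcal B$ evaluated through its formula. Conditions (i)–(iii) are the defining conditions of a Krasovskii quadratic control barrier certificate (K-QCBC) for $\Sigma$, with (iii) required there for some $u\in U$ at each $\mathbf x\in X^{h+1}$. *)

theory Defs
  imports "HOL-Probability.Probability"
begin

definition pos_semidef :: "real^'k^'k \<Rightarrow> bool" where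
  "pos_semidef M \<longleftrightarrow> transpose M = M \<and> (\<forall>v. v \<bullet> (M *v v) \<ge> 0)"

definition pos_def :: "real^'k^'k \<Rightarrow> bool" where
  "pos_def M \<longleftrightarrow> transpose M = M \<and> (\<forall>v. v \<noteq> 0 \<longrightarrow> v \<bullet> (M *v v) > 0)"

definition loewner_le :: "real^'k^'k \<Rightarrow> real^'k^'k \<Rightarrow> bool" where
  "loewner_le M N \<longleftrightarrow> pos_semidef (N - M)"

(* The 3 x 3 block matrix with the given upper triangle; each block below the
   diagonal is the transpose of its mirror image. *)
definition sym_block3 ::
  "real^'a^'a \<Rightarrow> real^'b^'a \<Rightarrow> real^'c^'a \<Rightarrow> real^'b^'b \<Rightarrow> real^'c^'b \<Rightarrow> real^'c^'c
   \<Rightarrow> real^('a + 'b + 'c)^('a + 'b + 'c)" where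
  "sym_block3 M11 M12 M13 M22 M23 M33 = (\<chi> i j.
     (case i of
        Inl a \<Rightarrow> (case j of Inl a' \<Rightarrow> M11 $ a $ a' | Inr (Inl b') \<Rightarrow> M12 $ a $ b' | Inr (Inr c') \<Rightarrow> M13 $ a $ c')
      | Inr (Inl b) \<Rightarrow> (case j of Inl a' \<Rightarrow> transpose M12 $ b $ a' | Inr (Inl b') \<Rightarrow> M22 $ b $ b' | Inr (Inr c') \<Rightarrow> M23 $ b $ c')
      | Inr (Inr c) \<Rightarrow> (case j of Inl a' \<Rightarrow> transpose M13 $ c $ a' | Inr (Inl b') \<Rightarrow> transpose M23 $ c $ b' | Inr (Inr c') \<Rightarrow> M33 $ c $ c')))"

(* A matrix whose entries are real polynomials in the 2n coordinates of (x, xh). *)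
definition polynomial_matrix :: "(real^'n \<Rightarrow> real^'n \<Rightarrow> real^'q^'p) \<Rightarrow> bool" where
  "polynomial_matrix M \<longleftrightarrow>
     (\<forall>i j. real_polynomial_function (\<lambda>z. M (fst z) (snd z) $ i $ j))"

(* The tuple (A, A1, G, E, X, U, h); in A, A1 and G the first argument is the
   current state and the second one the h-step delayed state. *)
record ('n, 'm) snps_td =
  mat_A :: "real^'n \<Rightarrow> real^'n \<Rightarrow> real^'n^'n"
  mat_A1 :: "real^'n \<Rightarrow> real^'n \<Rightarrow> real^'n^'n"
  mat_G :: "real^'n \<Rightarrow> real^'n \<Rightarrow> real^'m^'n"
  mat_E :: "real^'n^'n"
  state_set :: "(real^'n) set"
  input_set :: "(real^'m) set"
  delay :: nat

definition dt_SNPS_td :: "('n::finite, 'm::finite) snps_td \<Rightarrow> bool" where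
  "dt_SNPS_td \<Sigma> \<longleftrightarrow>
     polynomial_matrix (mat_A \<Sigma>) \<and> polynomial_matrix (mat_A1 \<Sigma>) \<and> polynomial_matrix (mat_G \<Sigma>) \<and>
     state_set \<Sigma> \<in> sets borel \<and> delay \<Sigma> \<ge> 1"

(* The density of N(0, I) on R^n is the product of n one-dimensional standard
   normal densities. *)
definition iid_std_normal :: "'w measure \<Rightarrow> (nat \<Rightarrow> 'w \<Rightarrow> real^'n) \<Rightarrow> bool" where
  "iid_std_normal M w \<longleftrightarrow>
     prob_space.indep_vars M (\<lambda>_. borel) w UNIV \<and>
     (\<forall>k. distributed M lborel (w k) (\<lambda>z. ennreal (\<Prod>i\<in>UNIV. std_normal_density (z $ i))))"

(* A history (x, x_1, ..., x_h) is a function on the naturals of which only the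
   values at 0, ..., h matter; index i is the state i steps ago. *)
type_synonym 'n history = "nat \<Rightarrow> real^'n"

definition next_state ::
  "('n::finite, 'm::finite) snps_td \<Rightarrow> 'n history \<Rightarrow> real^'m \<Rightarrow> real^'n \<Rightarrow> real^'n" where
  "next_state \<Sigma> xs u w =
     (let x = xs 0; xh = xs (delay \<Sigma>) in
      mat_A \<Sigma> x xh *v x + mat_A1 \<Sigma> x xh *v xh + mat_G \<Sigma> x xh *v u + mat_E \<Sigma> *v w)"

definition next_history ::
  "('n::finite, 'm::finite) snps_td \<Rightarrow> 'n history \<Rightarrow> real^'m \<Rightarrow> real^'n \<Rightarrow> 'n history" where
  "next_history \<Sigma> xs u w = (\<lambda>i. case i of 0 \<Rightarrow> next_state \<Sigma> xs u w | Suc j \<Rightarrow> xs j)"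

definition barrier :: "nat \<Rightarrow> real^'n^'n \<Rightarrow> real^'n^'n \<Rightarrow> 'n::finite history \<Rightarrow> real" where
  "barrier h P P1 xs = xs 0 \<bullet> (P *v xs 0) + (\<Sum>i=1..h. xs i \<bullet> (P1 *v xs i))"

definition state_feedback ::
  "(real^'n \<Rightarrow> real^'n \<Rightarrow> real^'n^'m) \<Rightarrow> (real^'n \<Rightarrow> real^'n \<Rightarrow> real^'n^'m)
   \<Rightarrow> real^'n \<Rightarrow> real^'n \<Rightarrow> real^'m" where
  "state_feedback F F1 x xh = F x xh *v x + F1 x xh *v xh"

end

(* Write y for the noise-free successor K x + K1 xh under the feedback, where K = A + G F and
   K1 = A1 + G F1.  Testing the block matrix inequality on (x, xh, - y / \<alpha>) and using S \<le> \<alpha> I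
   gives |y|^2 / \<alpha> \<le> x' (P - P1) x + xh' P1 xh, and P \<le> I / \<alpha> bounds y' P y by the left-hand
   side; no Schur complement or invertibility of S is needed.  The noise has mean 0 and
   covariance I, so it adds exactly Tr (E' P E) to the expectation, and the delayed terms of the
   barrier telescope.  Condition (i) is the average of the hypothesis on the initial set over the
   pairs (x, x_i). *)
theory Submission
  imports Defs
begin

section \<open>Block matrices and the matrix inequality\<close>

lemma sum_UNIV_sum_type:
  fixes f :: "'a::finite + 'b::finite \<Rightarrow> 'c::comm_monoid_add"
  shows "(\<Sum>i\<in>UNIV. f i) = (\<Sum>a\<in>UNIV. f (Inl a)) + (\<Sum>b\<in>UNIV. f (Inr b))"
  by (simp add: UNIV_Plus_UNIV[symmetric] sum.Plus del: UNIV_Plus_UNIV)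

text \<open>The index type is the nested sum used by \<open>sym_block3\<close>, so that testing the
  block matrix on such a vector splits into blocks.\<close>

definition block_vec3 :: "real^'a \<Rightarrow> real^'b \<Rightarrow> real^'c \<Rightarrow> real^('a + 'b + 'c)" where
  "block_vec3 a b c = (\<chi> i. case i of Inl k \<Rightarrow> a $ k | Inr (Inl k) \<Rightarrow> b $ k | Inr (Inr k) \<Rightarrow> c $ k)"

lemma inner_block_vec3:
  fixes a a' :: "real^'a::finite" and b b' :: "real^'b::finite" and c c' :: "real^'c::finite"
  shows "block_vec3 a b c \<bullet> block_vec3 a' b' c' = a \<bullet> a' + b \<bullet> b' + c \<bullet> c'"
  by (simp add: block_vec3_def inner_vec_def sum_UNIV_sum_type)

lemma sym_block3_mult_block_vec3:
  fixes a :: "real^'a::finite" and b :: "real^'b::finite" and c :: "real^'c::finite"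
  shows "sym_block3 M11 M12 M13 M22 M23 M33 *v block_vec3 a b c =
    block_vec3 (M11 *v a + M12 *v b + M13 *v c)
      (transpose M12 *v a + M22 *v b + M23 *v c)
      (transpose M13 *v a + transpose M23 *v b + M33 *v c)"
  by (simp add: vec_eq_iff block_vec3_def sym_block3_def matrix_vector_mult_def
      sum_UNIV_sum_type split: sum.split)

lemma loewner_le_scaled_id:
  assumes "loewner_le M (c *\<^sub>R mat 1)"
  shows "v \<bullet> (M *v v) \<le> c * (v \<bullet> v)"
  using assms
  by (simp add: loewner_le_def pos_semidef_def matrix_vector_mult_diff_rdistrib
      inner_diff_right scaleR_matrix_vector_assoc[symmetric])

lemma lmi_quadratic_bound:
  fixes P P1 S K K1 :: "real^'n::finite^'n" and x xh :: "real^'n"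
  assumes lmi: "pos_semidef (sym_block3 (P - P1) 0 (transpose K) P1 (transpose K1) S)"
    and P_le: "loewner_le P ((1 / \<alpha>) *\<^sub>R mat 1)" and S_le: "loewner_le S (\<alpha> *\<^sub>R mat 1)"
    and \<alpha>: "\<alpha> > 0"
  defines "y \<equiv> K *v x + K1 *v xh"
  shows "y \<bullet> (P *v y) \<le> x \<bullet> (P *v x) - x \<bullet> (P1 *v x) + xh \<bullet> (P1 *v xh)"
proof -
  \<comment> \<open>This choice minimises
    \<open>2 * (c \<bullet> y) + \<alpha> * (c \<bullet> c)\<close>, the part of the quadratic form
    that depends on \<open>c\<close> once \<open>S\<close> is replaced by its bound \<alpha> I. The
    minimum is - |y|^2 / \<alpha>.\<close>
  define c where "c = (- 1 / \<alpha>) *\<^sub>R y"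
  have adj: "u \<bullet> (v v* A) = (A *v u) \<bullet> v" for u v :: "real^'n" and A :: "real^'n^'n"
    by (metis dot_lmul_matrix inner_commute)
  have zero: "transpose (0::real^'n^'n) = 0" by (simp add: transpose_def vec_eq_iff)
  have "0 \<le> block_vec3 x xh c \<bullet>
      (sym_block3 (P - P1) 0 (transpose K) P1 (transpose K1) S *v block_vec3 x xh c)"
    using lmi by (simp add: pos_semidef_def)
  \<comment> \<open>Each coupling block occurs once in either triangle. Moved across the inner
    product, both copies pair \<open>c\<close> with \<open>K *v x\<close> or
    \<open>K1 *v xh\<close>, which together make \<open>y\<close>; hence the factor 2.\<close>
  also have "\<dots> = x \<bullet> (P *v x) - x \<bullet> (P1 *v x) + xh \<bullet> (P1 *v xh)
      + 2 * (c \<bullet> y) + c \<bullet> (S *v c)"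
    by (simp add: sym_block3_mult_block_vec3 inner_block_vec3 y_def inner_add_right
        inner_diff_right matrix_vector_mult_diff_rdistrib adj zero inner_commute[of c])
  finally have "0 \<le> x \<bullet> (P *v x) - x \<bullet> (P1 *v x) + xh \<bullet> (P1 *v xh) + 2 * (c \<bullet> y) + c \<bullet> (S *v c)" .
  moreover have "c \<bullet> (S *v c) \<le> (y \<bullet> y) / \<alpha>"
    using loewner_le_scaled_id[OF S_le, of c] \<alpha> by (simp add: c_def)
  moreover have "c \<bullet> y = - (y \<bullet> y) / \<alpha>" by (simp add: c_def)
  moreover have "y \<bullet> (P *v y) \<le> (y \<bullet> y) / \<alpha>"
    using loewner_le_scaled_id[OF P_le, of y] by simp
  ultimately show ?thesis by simp
qed

section \<open>Moments of a standard normal vector\<close>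

lemma lborel_vec_prod:
  fixes f :: "'n::finite \<Rightarrow> real \<Rightarrow> real"
  assumes f: "\<And>i. integrable lborel (f i)"
  shows "integrable lborel (\<lambda>z::real^'n. \<Prod>i\<in>UNIV. f i (z $ i))"
    and "(LINT z|lborel. (\<Prod>i\<in>UNIV. f i ((z::real^'n) $ i))) = (\<Prod>i\<in>UNIV. integral\<^sup>L lborel (f i))"
proof -
  \<comment> \<open>Fubini is applied on the product of one-dimensional Lebesgue measures over
    \<open>Basis\<close>, whose image under the map \<open>T\<close> below is \<open>lborel\<close>.
    What remains is to translate between indices \<open>i\<close> and basis vectors
    \<open>axis i 1\<close>.\<close>
  interpret product_sigma_finite "\<lambda>_::real^'n. lborel :: real measure"
    by standard
  have bij: "bij_betw (\<lambda>i::'n. axis i (1::real)) UNIV Basis"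
    by (auto simp: bij_betw_def Basis_vec_def inj_on_def axis_eq_axis)
  \<comment> \<open>Off \<open>Basis\<close> the chosen index is unspecified, but \<open>g b\<close>
    is still one of the \<open>f i\<close>, so integrability holds for every
    \<open>b\<close>.\<close>
  define g where "g b = f (THE i. b = axis i (1::real))" for b :: "real^'n"
  have g: "g (axis i 1) = f i" for i
    unfolding g_def by (rule arg_cong[of _ _ f]) (auto simp: axis_eq_axis)
  have g_int: "integrable lborel (g b)" for b using f by (simp add: g_def)
  define T where "T h = (\<Sum>b\<in>Basis. h b *\<^sub>R b)" for h :: "real^'n \<Rightarrow> real"
  have [measurable]: "f i \<in> borel_measurable borel" for i
    using borel_measurable_integrable[OF f] by simp
  have T: "T \<in> measurable (\<Pi>\<^sub>M b\<in>Basis. lborel) borel" unfolding T_def by measurable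
  have T_nth: "T h $ i = h (axis i 1)" for h i
  proof -
    have "T h $ i = T h \<bullet> axis i 1" by (simp add: inner_axis)
    also have "\<dots> = h (axis i 1)"
      unfolding T_def by (rule inner_sum_left_Basis) (simp add: axis_in_Basis_iff)
    finally show ?thesis .
  qed
  have prod: "(\<Prod>i\<in>UNIV. f i (T h $ i)) = (\<Prod>b\<in>Basis. g b (h b))" for h
    using prod.reindex_bij_betw[OF bij, of "\<lambda>b. g b (h b)"] by (simp add: T_nth g)
  have eq: "(lborel :: (real^'n) measure) = distr (\<Pi>\<^sub>M b\<in>Basis. lborel) borel T"
    unfolding T_def by (rule lborel_eq)
  have m: "(\<lambda>z::real^'n. \<Prod>i\<in>UNIV. f i (z $ i)) \<in> borel_measurable borel" by measurable
  show "integrable lborel (\<lambda>z::real^'n. \<Prod>i\<in>UNIV. f i (z $ i))"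
    unfolding eq integrable_distr_eq[OF T m] prod
    by (rule product_integrable_prod) (auto intro: g_int)
  have "(LINT z|lborel. (\<Prod>i\<in>UNIV. f i ((z::real^'n) $ i))) = (\<Prod>b\<in>Basis. integral\<^sup>L lborel (g b))"
    unfolding eq integral_distr[OF T m] prod
    by (rule product_integral_prod) (auto intro: g_int)
  also have "\<dots> = (\<Prod>i\<in>UNIV. integral\<^sup>L lborel (f i))"
    using prod.reindex_bij_betw[OF bij, of "\<lambda>b. integral\<^sup>L lborel (g b)"] by (simp add: g)
  finally show "(LINT z|lborel. (\<Prod>i\<in>UNIV. f i ((z::real^'n) $ i))) = (\<Prod>i\<in>UNIV. integral\<^sup>L lborel (f i))" .
qed

text \<open>Mass, mean and variance suffice because the barrier is quadratic in the noise. They are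
  the cases k = 0 and k = 1 of the even moments 2k and the case k = 0 of the odd moments 2k +
  1.\<close>

lemma std_normal_low_moments:
  "(LINT t|lborel. std_normal_density t) = 1"
  "(LINT t|lborel. std_normal_density t * t) = 0"
  "(LINT t|lborel. std_normal_density t * t\<^sup>2) = 1"
  using has_bochner_integral_integral_eq[OF std_normal_moment_even[of 0]]
    has_bochner_integral_integral_eq[OF std_normal_moment_odd[of 0]]
    has_bochner_integral_integral_eq[OF std_normal_moment_even[of 1]]
  by simp_all

context
  fixes M :: "'w measure" and W :: "'w \<Rightarrow> real^'n::finite"
  assumes normal: "distributed M lborel W (\<lambda>z. ennreal (\<Prod>i\<in>UNIV. std_normal_density (z $ i)))"
begin

text \<open>The density is a product over coordinates, so its product with a monomial is again one,
  and the integral factors by \<open>lborel_vec_prod\<close>. Means and covariances follow by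
  choosing the exponents \<open>d\<close>.\<close>

lemma std_normal_vec_monomial:
  fixes d :: "'n \<Rightarrow> nat"
  shows "integrable M (\<lambda>\<omega>. \<Prod>i\<in>UNIV. W \<omega> $ i ^ d i)"
    and "integral\<^sup>L M (\<lambda>\<omega>. \<Prod>i\<in>UNIV. W \<omega> $ i ^ d i)
      = (\<Prod>i\<in>UNIV. LINT t|lborel. std_normal_density t * t ^ d i)"
proof -
  have m: "(\<lambda>z::real^'n. \<Prod>i\<in>UNIV. z $ i ^ d i) \<in> borel_measurable lborel" by measurable
  have pos: "0 \<le> (\<Prod>i\<in>UNIV. std_normal_density (z $ i))" for z :: "real^'n"
    by (intro prod_nonneg) simp
  have I: "integrable lborel (\<lambda>t. std_normal_density t * t ^ k)" for k
    by (rule integrable_std_normal_moment)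
  show "integrable M (\<lambda>\<omega>. \<Prod>i\<in>UNIV. W \<omega> $ i ^ d i)"
    using lborel_vec_prod(1)[of "\<lambda>i t. std_normal_density t * t ^ d i", OF I]
    by (subst distributed_integrable[OF normal m pos, symmetric]) (simp add: prod.distrib)
  show "integral\<^sup>L M (\<lambda>\<omega>. \<Prod>i\<in>UNIV. W \<omega> $ i ^ d i)
      = (\<Prod>i\<in>UNIV. LINT t|lborel. std_normal_density t * t ^ d i)"
    using lborel_vec_prod(2)[of "\<lambda>i t. std_normal_density t * t ^ d i", OF I]
    by (subst distributed_integral[OF normal m pos, symmetric]) (simp add: prod.distrib)
qed

lemma std_normal_vec_mean:
  shows "integrable M (\<lambda>\<omega>. W \<omega> $ i)" and "integral\<^sup>L M (\<lambda>\<omega>. W \<omega> $ i) = 0"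
proof -
  \<comment> \<open>Exponent 1 at \<open>i\<close> and 0 elsewhere isolates one coordinate; in the
    integral, the factor at \<open>i\<close> is then the vanishing mean.\<close>
  have eq: "(\<Prod>j\<in>UNIV. W \<omega> $ j ^ of_bool (j = i)) = W \<omega> $ i" for \<omega>
    by (subst prod.remove[of _ i]) auto
  show "integrable M (\<lambda>\<omega>. W \<omega> $ i)"
    using std_normal_vec_monomial(1)[of "\<lambda>j. of_bool (j = i)"] by (simp only: eq)
  have "integral\<^sup>L M (\<lambda>\<omega>. W \<omega> $ i)
      = (\<Prod>j\<in>UNIV. LINT t|lborel. std_normal_density t * t ^ of_bool (j = i))"
    using std_normal_vec_monomial(2)[of "\<lambda>j. of_bool (j = i)"] by (simp only: eq)
  also have "\<dots> = 0"
    by (rule prod_zero) (auto intro!: bexI[of _ i] simp: std_normal_low_moments)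
  finally show "integral\<^sup>L M (\<lambda>\<omega>. W \<omega> $ i) = 0" .
qed

lemma std_normal_vec_covariance:
  shows "integrable M (\<lambda>\<omega>. W \<omega> $ i * W \<omega> $ j)"
    and "integral\<^sup>L M (\<lambda>\<omega>. W \<omega> $ i * W \<omega> $ j) = of_bool (i = j)"
proof -
  \<comment> \<open>The exponents add up: 2 at the common index if \<open>i = j\<close>, otherwise 1
    at each of the two.\<close>
  define d :: "'n \<Rightarrow> nat" where "d k = of_bool (k = i) + of_bool (k = j)" for k
  have single: "(\<Prod>l\<in>UNIV. W \<omega> $ l ^ of_bool (l = k)) = W \<omega> $ k" for \<omega> k
    by (subst prod.remove[of _ k]) auto
  have eq: "(\<Prod>k\<in>UNIV. W \<omega> $ k ^ d k) = W \<omega> $ i * W \<omega> $ j" for \<omega>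
    by (simp add: d_def power_add prod.distrib single)
  show "integrable M (\<lambda>\<omega>. W \<omega> $ i * W \<omega> $ j)"
    using std_normal_vec_monomial(1)[of d] by (simp only: eq)
  have "integral\<^sup>L M (\<lambda>\<omega>. W \<omega> $ i * W \<omega> $ j)
      = (\<Prod>k\<in>UNIV. LINT t|lborel. std_normal_density t * t ^ d k)"
    using std_normal_vec_monomial(2)[of d] by (simp only: eq)
  also have "\<dots> = of_bool (i = j)"
  proof (cases "i = j")
    case True
    \<comment> \<open>At \<open>k = j\<close> the factor is the variance, elsewhere the total mass;
      both equal 1.\<close>
    then have "(LINT t|lborel. std_normal_density t * t ^ d k) = 1" for k
      by (cases "k = j") (simp_all add: d_def std_normal_low_moments flip: power2_eq_square)
    then show ?thesis using True by simp
  next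
    case False
    \<comment> \<open>For distinct indices the factor at \<open>i\<close> is the mean, so the
      product vanishes.\<close>
    then show ?thesis
      by (auto intro!: prod_zero bexI[of _ i] simp: d_def std_normal_low_moments)
  qed
  finally show "integral\<^sup>L M (\<lambda>\<omega>. W \<omega> $ i * W \<omega> $ j) = of_bool (i = j)" .
qed

lemma std_normal_vec_inner:
  shows "integrable M (\<lambda>\<omega>. c \<bullet> W \<omega>)" and "integral\<^sup>L M (\<lambda>\<omega>. c \<bullet> W \<omega>) = 0"
  by (simp_all add: inner_vec_def std_normal_vec_mean)

text \<open>In the expansion into products of coordinates, the identity covariance keeps only the
  diagonal of \<open>Q\<close>.\<close>

lemma std_normal_vec_quadratic:
  shows "integrable M (\<lambda>\<omega>. W \<omega> \<bullet> (Q *v W \<omega>))"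
    and "integral\<^sup>L M (\<lambda>\<omega>. W \<omega> \<bullet> (Q *v W \<omega>)) = trace Q"
proof -
  have eq: "W \<omega> \<bullet> (Q *v W \<omega>) = (\<Sum>i\<in>UNIV. \<Sum>j\<in>UNIV. Q $ i $ j * (W \<omega> $ i * W \<omega> $ j))" for \<omega>
    by (simp add: inner_vec_def matrix_vector_mult_def sum_distrib_left mult_ac)
  show "integrable M (\<lambda>\<omega>. W \<omega> \<bullet> (Q *v W \<omega>))"
    unfolding eq by (intro Bochner_Integration.integrable_sum integrable_mult_right
        std_normal_vec_covariance)
  have "integral\<^sup>L M (\<lambda>\<omega>. W \<omega> \<bullet> (Q *v W \<omega>))
      = (\<Sum>i\<in>UNIV. \<Sum>j\<in>UNIV. Q $ i $ j * of_bool (i = j))"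
    unfolding eq by (simp add: std_normal_vec_covariance)
  also have "\<dots> = trace Q"
    by (simp add: trace_def of_bool_def if_distrib cong: if_cong)
  finally show "integral\<^sup>L M (\<lambda>\<omega>. W \<omega> \<bullet> (Q *v W \<omega>)) = trace Q" .
qed

text \<open>Source of the constant \<eta>: the term linear in the noise has mean 0, and the
  quadratic one averages to the trace.\<close>

lemma std_normal_vec_affine_quadratic:
  fixes P E :: "real^'n^'n"
  assumes M: "prob_space M" and P: "transpose P = P"
  shows "integrable M (\<lambda>\<omega>. (y + E *v W \<omega>) \<bullet> (P *v (y + E *v W \<omega>)))"
    and "integral\<^sup>L M (\<lambda>\<omega>. (y + E *v W \<omega>) \<bullet> (P *v (y + E *v W \<omega>)))
      = y \<bullet> (P *v y) + trace (transpose E ** P ** E)"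
proof -
  interpret prob_space M by (rule M)
  \<comment> \<open>Symmetry of \<open>P\<close> makes the two cross terms equal, whence the factor
    2.\<close>
  define c where "c = 2 *\<^sub>R (transpose E *v (P *v y))"
  have adj: "u \<bullet> (A *v v) = (transpose A *v u) \<bullet> v" for u v :: "real^'n" and A :: "real^'n^'n"
    by (simp add: dot_lmul_matrix)
  have cross: "u \<bullet> (P *v y) = y \<bullet> (P *v u)" for u
    using adj[of u P y] by (simp add: P inner_commute)
  have eq: "(y + E *v W \<omega>) \<bullet> (P *v (y + E *v W \<omega>))
      = y \<bullet> (P *v y) + (c \<bullet> W \<omega> + W \<omega> \<bullet> ((transpose E ** P ** E) *v W \<omega>))" for \<omega>
  proof -
    have "(y + E *v W \<omega>) \<bullet> (P *v (y + E *v W \<omega>))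
        = y \<bullet> (P *v y) + (2 * ((P *v y) \<bullet> (E *v W \<omega>)) + (E *v W \<omega>) \<bullet> (P *v (E *v W \<omega>)))"
      using cross[of "E *v W \<omega>"]
      by (simp add: matrix_vector_right_distrib inner_add_left inner_add_right inner_commute)
    also have "(P *v y) \<bullet> (E *v W \<omega>) = (transpose E *v (P *v y)) \<bullet> W \<omega>"
      by (rule adj)
    also have "(E *v W \<omega>) \<bullet> (P *v (E *v W \<omega>)) = W \<omega> \<bullet> ((transpose E ** P ** E) *v W \<omega>)"
      using adj[of "P *v (E *v W \<omega>)" E "W \<omega>"]
      by (simp add: matrix_vector_mul_assoc[symmetric] inner_commute)
    finally show ?thesis by (simp add: c_def)
  qed
  show "integrable M (\<lambda>\<omega>. (y + E *v W \<omega>) \<bullet> (P *v (y + E *v W \<omega>)))"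
    unfolding eq by (intro Bochner_Integration.integrable_add std_normal_vec_inner
        std_normal_vec_quadratic integrable_const)
  show "integral\<^sup>L M (\<lambda>\<omega>. (y + E *v W \<omega>) \<bullet> (P *v (y + E *v W \<omega>)))
      = y \<bullet> (P *v y) + trace (transpose E ** P ** E)"
    unfolding eq by (simp add: std_normal_vec_inner std_normal_vec_quadratic prob_space)
qed

end

section \<open>The barrier along histories and the certificate conditions\<close>

lemma barrier_le_of_pairs:
  assumes "h \<ge> 1"
    and "\<And>i. i \<in> {1..h} \<Longrightarrow> xs 0 \<bullet> (P *v xs 0) + real h * (xs i \<bullet> (P1 *v xs i)) \<le> \<gamma>"
  shows "barrier h P P1 xs \<le> \<gamma>"
proof -
  \<comment> \<open>The sum contains the current term h times and h times each delayed term, that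
    is, h times the barrier; h \<ge> 1 permits the division.\<close>
  have "(\<Sum>i=1..h. xs 0 \<bullet> (P *v xs 0) + real h * (xs i \<bullet> (P1 *v xs i))) \<le> (\<Sum>i=1..h. \<gamma>)"
    by (rule sum_mono) (rule assms(2))
  then have "real h * barrier h P P1 xs \<le> real h * \<gamma>"
    by (simp add: barrier_def sum.distrib sum_distrib_left distrib_left)
  then show ?thesis using assms(1) by simp
qed

text \<open>The shift puts the current state into the first delayed slot and drops the oldest one.
  In this form the noise \<open>v\<close> enters only through \<open>next_state\<close>, and the
  bracket is constant under the expectation.\<close>

lemma barrier_next_history:
  assumes "delay \<Sigma> \<ge> 1"
  shows "barrier (delay \<Sigma>) P P1 (next_history \<Sigma> xs u v)
    = next_state \<Sigma> xs u v \<bullet> (P *v next_state \<Sigma> xs u v)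
      + (barrier (delay \<Sigma>) P P1 xs - xs 0 \<bullet> (P *v xs 0)
         + xs 0 \<bullet> (P1 *v xs 0) - xs (delay \<Sigma>) \<bullet> (P1 *v xs (delay \<Sigma>)))"
proof -
  obtain k where k: "delay \<Sigma> = Suc k" using assms by (cases "delay \<Sigma>") auto
  define q where "q i = xs i \<bullet> (P1 *v xs i)" for i
  have "(\<Sum>i=1..Suc k. next_history \<Sigma> xs u v i \<bullet> (P1 *v next_history \<Sigma> xs u v i)) = (\<Sum>i\<le>k. q i)"
    using sum.shift_bounds_cl_Suc_ivl[of
        "\<lambda>i. next_history \<Sigma> xs u v i \<bullet> (P1 *v next_history \<Sigma> xs u v i)" 0 k]
    by (simp add: next_history_def q_def atMost_atLeast0)
  \<comment> \<open>Both sides are the sum of \<open>q\<close> over 0 to \<open>Suc k\<close>, split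
    at the top and at the bottom index.\<close>
  moreover have "(\<Sum>i\<le>k. q i) + q (Suc k) = q 0 + (\<Sum>i=1..Suc k. q i)"
    using sum.atMost_Suc[of q k] sum.atMost_shift[of q "Suc k"]
    by (simp only: sum.atLeast1_atMost_eq One_nat_def)
  ultimately show ?thesis
    unfolding barrier_def k by (simp add: next_history_def q_def)
qed

theorem theorem3p6:
  fixes \<Sigma> :: "('n::finite, 'm::finite) snps_td"
    and M :: "'w measure" and w :: "nat \<Rightarrow> 'w \<Rightarrow> real^'n"
    and b :: "nat \<Rightarrow> real^'m" and J :: nat
    and X\<^sub>a X\<^sub>b :: "(real^'n) set"
    and \<gamma>\<^sub>a \<gamma>\<^sub>b \<alpha> :: real
    and P P1 S :: "real^'n^'n"
    and F F1 :: "real^'n \<Rightarrow> real^'n \<Rightarrow> real^'n^'m"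
  assumes sys: "dt_SNPS_td \<Sigma>"
    and prob: "prob_space M" and noise: "iid_std_normal M w"
    and inputs: "input_set \<Sigma> = {u. \<forall>j\<in>{1..J}. b j \<bullet> u \<le> 1}"
    and initial: "X\<^sub>a \<subseteq> state_set \<Sigma>" and unsafe: "X\<^sub>b \<subseteq> state_set \<Sigma>"
    and levels: "\<gamma>\<^sub>a > 0" "\<gamma>\<^sub>b > 0" "\<gamma>\<^sub>b > \<gamma>\<^sub>a"
    and P: "pos_def P" and P1: "pos_semidef P1" and S: "transpose S = S"
    and F: "polynomial_matrix F" and F1: "polynomial_matrix F1"
    and \<alpha>: "\<alpha> > 0"
    and on_initial: "\<forall>x\<in>X\<^sub>a. \<forall>x'\<in>X\<^sub>a. x \<bullet> (P *v x) + real (delay \<Sigma>) * (x' \<bullet> (P1 *v x')) \<le> \<gamma>\<^sub>a"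
    and on_unsafe: "\<forall>x\<in>X\<^sub>b. x \<bullet> (P *v x) \<ge> \<gamma>\<^sub>b"
    and lmi: "\<forall>x\<in>state_set \<Sigma>. \<forall>xh\<in>state_set \<Sigma>.
      pos_semidef (sym_block3
        (P - P1) 0  (transpose (mat_A \<Sigma> x xh + mat_G \<Sigma> x xh ** F x xh))
                 P1 (transpose (mat_A1 \<Sigma> x xh + mat_G \<Sigma> x xh ** F1 x xh))
                    S)"
    and P_le: "loewner_le P ((1 / \<alpha>) *\<^sub>R mat 1)" and S_le: "loewner_le S (\<alpha> *\<^sub>R mat 1)"
    and input_cond: "\<forall>x\<in>state_set \<Sigma>. \<forall>xh\<in>state_set \<Sigma>. \<forall>j\<in>{1..J}.
      1 - b j \<bullet> (F x xh *v x + F1 x xh *v xh) \<ge> 0"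
  shows "(\<forall>xs. (\<forall>i\<le>delay \<Sigma>. xs i \<in> X\<^sub>a) \<longrightarrow> barrier (delay \<Sigma>) P P1 xs \<le> \<gamma>\<^sub>a)
    \<and> (\<forall>xs. xs 0 \<in> X\<^sub>b \<and> (\<forall>i\<in>{1..delay \<Sigma>}. xs i \<in> state_set \<Sigma> - X\<^sub>b)
         \<longrightarrow> barrier (delay \<Sigma>) P P1 xs \<ge> \<gamma>\<^sub>b)
    \<and> (\<forall>xs k. (\<forall>i\<le>delay \<Sigma>. xs i \<in> state_set \<Sigma>) \<longrightarrow>
         (let u = state_feedback F F1 (xs 0) (xs (delay \<Sigma>));
              B_next = (\<lambda>\<omega>. barrier (delay \<Sigma>) P P1 (next_history \<Sigma> xs u (w k \<omega>)))
          in integrable M B_next \<and>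
             prob_space.expectation M B_next - barrier (delay \<Sigma>) P P1 xs
               \<le> trace (transpose (mat_E \<Sigma>) ** P ** mat_E \<Sigma>)))
    \<and> (\<forall>x\<in>state_set \<Sigma>. \<forall>xh\<in>state_set \<Sigma>. state_feedback F F1 x xh \<in> input_set \<Sigma>)"
proof -
  have h: "delay \<Sigma> \<ge> 1" using sys by (simp add: dt_SNPS_td_def)
  have P_sym: "transpose P = P" using P by (simp add: pos_def_def)
  show ?thesis
  proof (intro conjI allI impI ballI)
    fix xs :: "nat \<Rightarrow> real^'n"
    assume "\<forall>i\<le>delay \<Sigma>. xs i \<in> X\<^sub>a"
    then show "barrier (delay \<Sigma>) P P1 xs \<le> \<gamma>\<^sub>a"
      using on_initial h by (intro barrier_le_of_pairs) auto
  next
    fix xs :: "nat \<Rightarrow> real^'n"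
    assume "xs 0 \<in> X\<^sub>b \<and> (\<forall>i\<in>{1..delay \<Sigma>}. xs i \<in> state_set \<Sigma> - X\<^sub>b)"
    then have "\<gamma>\<^sub>b \<le> xs 0 \<bullet> (P *v xs 0)" using on_unsafe by simp
    \<comment> \<open>The delayed terms can only raise the barrier, since \<open>P1\<close> is
      positive semidefinite.\<close>
    moreover have "0 \<le> (\<Sum>i=1..delay \<Sigma>. xs i \<bullet> (P1 *v xs i))"
      using P1 by (intro sum_nonneg) (simp add: pos_semidef_def)
    ultimately show "barrier (delay \<Sigma>) P P1 xs \<ge> \<gamma>\<^sub>b" by (simp add: barrier_def)
  next
    \<comment> \<open>With the history fixed, the feedback input is a constant vector, so the
      conditional expectation becomes an expectation over the law of \<open>w k\<close>.\<close>
    fix xs :: "nat \<Rightarrow> real^'n" and k :: nat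
    assume "\<forall>i\<le>delay \<Sigma>. xs i \<in> state_set \<Sigma>"
    then have mem: "xs 0 \<in> state_set \<Sigma>" "xs (delay \<Sigma>) \<in> state_set \<Sigma>" by auto
    define x xh where "x = xs 0" and "xh = xs (delay \<Sigma>)"
    define K K1 where "K = mat_A \<Sigma> x xh + mat_G \<Sigma> x xh ** F x xh"
      and "K1 = mat_A1 \<Sigma> x xh + mat_G \<Sigma> x xh ** F1 x xh"
    define y where "y = K *v x + K1 *v xh"
    define u where "u = state_feedback F F1 x xh"
    \<comment> \<open>Inserting the feedback regroups the dynamics into the closed-loop matrices
      \<open>K\<close> and \<open>K1\<close>, which are those in the matrix inequality.\<close>
    have next_eq: "next_state \<Sigma> xs u v = y + mat_E \<Sigma> *v v" for v
      by (simp add: next_state_def u_def y_def K_def K1_def state_feedback_def Let_def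
          x_def[symmetric] xh_def[symmetric] matrix_vector_mult_add_rdistrib
          matrix_vector_right_distrib matrix_vector_mul_assoc[symmetric])
    have y_le: "y \<bullet> (P *v y) \<le> x \<bullet> (P *v x) - x \<bullet> (P1 *v x) + xh \<bullet> (P1 *v xh)"
      unfolding y_def
      by (rule lmi_quadratic_bound[OF _ P_le S_le \<alpha>])
        (use lmi mem in \<open>simp add: K_def K1_def x_def xh_def\<close>)
    have normal: "distributed M lborel (w k) (\<lambda>z. ennreal (\<Prod>i\<in>UNIV. std_normal_density (z $ i)))"
      using noise by (simp add: iid_std_normal_def)
    note quad = std_normal_vec_affine_quadratic[OF normal prob P_sym, of y "mat_E \<Sigma>"]
    interpret prob_space M by (rule prob)
    \<comment> \<open>The expected increase is the trace plus \<open>y \<bullet> (P *v y)\<close>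
      minus the right-hand side of \<open>y_le\<close>, hence at most the trace.\<close>
    show "let u = state_feedback F F1 (xs 0) (xs (delay \<Sigma>));
              B_next = (\<lambda>\<omega>. barrier (delay \<Sigma>) P P1 (next_history \<Sigma> xs u (w k \<omega>)))
          in integrable M B_next \<and>
             expectation B_next - barrier (delay \<Sigma>) P P1 xs
               \<le> trace (transpose (mat_E \<Sigma>) ** P ** mat_E \<Sigma>)"
      unfolding Let_def x_def[symmetric] xh_def[symmetric] u_def[symmetric]
        barrier_next_history[OF h] next_eq
      using y_le quad by (simp add: prob_space)
  next
    fix x xh
    assume "x \<in> state_set \<Sigma>" "xh \<in> state_set \<Sigma>"
    then show "state_feedback F F1 x xh \<in> input_set \<Sigma>"
      using input_cond by (simp add: inputs state_feedback_def)
  qed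
qed

end
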